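(* Let $M_R$ be the countable metric graph defined in the context. a) Let $X$ be a Banach space and $D\in[1,2)$. If $M_R$ Lipschitz embeds into $X$ with distortion $D$, then $X$ is non-reflexive. b) Conversely, if $X$ is a non-reflexive Banach space, then there is an equivalent norm $|\cdot|$ on $X$ such that $M_R$ embeds isometrically into $(X,|\cdot|)$.
   Context: $\mathbb N=\{1,2,\dots\}$; for integers $m\le n$, $\llbracket m,n\rrbracket=[m,n]\cap\mathbb N$ and $\llbracket m,\infty\llbracket=[m,\infty)\cap\mathbb N$. The metric space $M_R$: its vertex set is $\{\mathbf 0\}\cup\mathbb N\cup F$ (a disjoint union, where $\mathbf 0$ is an additional point), with $F=\{\llbracket 1,n\rrbracket:n\in\mathbb N\}\cup\{\llbracket n,\infty\llbracket:n\in\mathbb N\}$. The edges are the pairs $\{\mathbf 0,a\}$ with $a\in\mathbb N$, and the pairs $\{a,A\}$ with $a\in\mathbb N$, $A\in F$ and $a\in A$. $M_R$ is equipped with the shortest path distance. Lipschitz embeddings: a map $f:(M,d)\to(N,\rho)$ between metric spaces is a Lipschitz embedding if there are constants $C_1,C_2>0$ with $C_1d(x,y)\le\rho(f(x),f(y))\le C_2d(x,y)$ for all $x,y\in M$. Its distortion is the infimum of $C_2/C_1$ over all such constants. $M$ Lipschitz embeds into $N$ with distortion $D$ if there is a Lipschitz embedding $f:M\to N$ whose distortion is at most $D$. *)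

theory Defs
  imports "HOL-Analysis.Analysis"
begin

section \<open>The shortest path distance of a graph\<close>

text \<open>A graph is given by its set of edges, each edge being an unordered pair \<open>{x, y}\<close>.
  A pair lies in \<^term>\<open>adj E ^^ n\<close> iff its entries are joined by an edge path of length \<open>n\<close>.\<close>

definition adj :: "'v set set \<Rightarrow> ('v \<times> 'v) set" where
  "adj E = {(x, y). {x, y} \<in> E}"

definition path_dist :: "'v set set \<Rightarrow> 'v \<Rightarrow> 'v \<Rightarrow> real" where
  "path_dist E x y = real (LEAST n. (x, y) \<in> adj E ^^ n)"

section \<open>The graph \<open>M\<^sub>R\<close>\<close>

text \<open>The three constructors make the union of \<open>{0}\<close>, \<open>\<nat>\<close> and \<open>F\<close> disjoint; the naturals of
  the construction start at 1.\<close>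

datatype vertex = Origin | Point nat | Segment "nat set"

definition MR_F :: "nat set set" where
  "MR_F = {{1..n} |n. 1 \<le> n} \<union> {{n..} |n. 1 \<le> n}"

definition MR_verts :: "vertex set" where
  "MR_verts = {Origin} \<union> Point ` {1..} \<union> Segment ` MR_F"

definition MR_edges :: "vertex set set" where
  "MR_edges = {{Origin, Point a} |a. 1 \<le> a} \<union>
    {{Point a, Segment A} |a A. 1 \<le> a \<and> A \<in> MR_F \<and> a \<in> A}"

definition MR_dist :: "vertex \<Rightarrow> vertex \<Rightarrow> real" where
  "MR_dist = path_dist MR_edges"

section \<open>Lipschitz and isometric embeddings\<close>

definition lipschitz_bounds ::
  "'a set \<Rightarrow> ('a \<Rightarrow> 'a \<Rightarrow> real) \<Rightarrow> ('b \<Rightarrow> 'b \<Rightarrow> real) \<Rightarrow> ('a \<Rightarrow> 'b) \<Rightarrow> real \<Rightarrow> real \<Rightarrow> bool" where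
  "lipschitz_bounds M d \<rho> f C1 C2 \<longleftrightarrow> 0 < C1 \<and> 0 < C2 \<and>
    (\<forall>x\<in>M. \<forall>y\<in>M. C1 * d x y \<le> \<rho> (f x) (f y) \<and> \<rho> (f x) (f y) \<le> C2 * d x y)"

definition lipschitz_embedding ::
  "'a set \<Rightarrow> ('a \<Rightarrow> 'a \<Rightarrow> real) \<Rightarrow> 'b set \<Rightarrow> ('b \<Rightarrow> 'b \<Rightarrow> real) \<Rightarrow> ('a \<Rightarrow> 'b) \<Rightarrow> bool" where
  "lipschitz_embedding M d N \<rho> f \<longleftrightarrow> f \<in> M \<rightarrow> N \<and> (\<exists>C1 C2. lipschitz_bounds M d \<rho> f C1 C2)"

definition distortion ::
  "'a set \<Rightarrow> ('a \<Rightarrow> 'a \<Rightarrow> real) \<Rightarrow> ('b \<Rightarrow> 'b \<Rightarrow> real) \<Rightarrow> ('a \<Rightarrow> 'b) \<Rightarrow> real" where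
  "distortion M d \<rho> f = Inf {C2 / C1 |C1 C2. lipschitz_bounds M d \<rho> f C1 C2}"

definition lipschitz_embeds ::
  "'a set \<Rightarrow> ('a \<Rightarrow> 'a \<Rightarrow> real) \<Rightarrow> 'b set \<Rightarrow> ('b \<Rightarrow> 'b \<Rightarrow> real) \<Rightarrow> real \<Rightarrow> bool" where
  "lipschitz_embeds M d N \<rho> D \<longleftrightarrow>
    (\<exists>f. lipschitz_embedding M d N \<rho> f \<and> distortion M d \<rho> f \<le> D)"

definition isometrically_embeds ::
  "'a set \<Rightarrow> ('a \<Rightarrow> 'a \<Rightarrow> real) \<Rightarrow> 'b set \<Rightarrow> ('b \<Rightarrow> 'b \<Rightarrow> real) \<Rightarrow> bool" where
  "isometrically_embeds M d N \<rho> \<longleftrightarrow>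
    (\<exists>f\<in>M \<rightarrow> N. \<forall>x\<in>M. \<forall>y\<in>M. \<rho> (f x) (f y) = d x y)"

section \<open>Reflexivity and equivalent norms\<close>

text \<open>\<^term>\<open>blinfun.prod_left x\<close> is evaluation at \<open>x\<close>, as a functional on the dual space.\<close>

definition canonical_embedding ::
  "'a::real_normed_vector \<Rightarrow> (('a \<Rightarrow>\<^sub>L real) \<Rightarrow>\<^sub>L real)" where
  "canonical_embedding x = blinfun.prod_left x"

lemma canonical_embedding_apply [simp]:
  "blinfun_apply (canonical_embedding x) f = blinfun_apply f x"
  by (simp add: canonical_embedding_def)

definition reflexive_space :: "'a::real_normed_vector itself \<Rightarrow> bool" where
  "reflexive_space _ \<longleftrightarrow> surj (canonical_embedding :: 'a \<Rightarrow> (('a \<Rightarrow>\<^sub>L real) \<Rightarrow>\<^sub>L real))"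

definition is_norm :: "('a::real_vector \<Rightarrow> real) \<Rightarrow> bool" where
  "is_norm N \<longleftrightarrow> (\<forall>x. 0 \<le> N x) \<and> (\<forall>x. N x = 0 \<longleftrightarrow> x = 0) \<and>
    (\<forall>c x. N (c *\<^sub>R x) = \<bar>c\<bar> * N x) \<and> (\<forall>x y. N (x + y) \<le> N x + N y)"

definition equivalent_norm :: "('a::real_normed_vector \<Rightarrow> real) \<Rightarrow> bool" where
  "equivalent_norm N \<longleftrightarrow> is_norm N \<and>
    (\<exists>a b. 0 < a \<and> 0 < b \<and> (\<forall>x. a * norm x \<le> N x \<and> N x \<le> b * norm x))"

section \<open>\<open>M\<^sub>R\<close> is a metric space\<close>

lemma Metric_space_path_dist:
  assumes conn: "\<And>x y. \<lbrakk>x \<in> V; y \<in> V\<rbrakk> \<Longrightarrow> (x, y) \<in> (adj E)\<^sup>*"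
  shows "Metric_space V (path_dist E)"
proof
  have sym: "(y, x) \<in> adj E ^^ n" if "(x, y) \<in> adj E ^^ n" for x y n
    using that
  proof (induction n arbitrary: y)
    case (Suc n)
    then obtain z where "(x, z) \<in> adj E ^^ n" "(z, y) \<in> adj E" by auto
    then have "(z, x) \<in> adj E ^^ n" "(y, z) \<in> adj E"
      using Suc.IH by (auto simp: adj_def insert_commute)
    then show ?case by (meson relpow_Suc_I2)
  qed auto
  have short: "(x, y) \<in> adj E ^^ (LEAST n. (x, y) \<in> adj E ^^ n)" if "x \<in> V" "y \<in> V" for x y
    using conn[OF that] by (metis LeastI rtrancl_imp_relpow)
  show "0 \<le> path_dist E x y" for x y by (simp add: path_dist_def)
  show "path_dist E x y = path_dist E y x" for x y
  proof -
    have "(\<lambda>n. (x, y) \<in> adj E ^^ n) = (\<lambda>n. (y, x) \<in> adj E ^^ n)"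
      using sym by blast
    then show ?thesis by (simp add: path_dist_def)
  qed
  show "path_dist E x y = 0 \<longleftrightarrow> x = y" if "x \<in> V" "y \<in> V" for x y
    using short[OF that] by (auto simp: path_dist_def intro!: Least_eq_0)
  show "path_dist E x z \<le> path_dist E x y + path_dist E y z"
    if "x \<in> V" "y \<in> V" "z \<in> V" for x y z
  proof -
    have "(x, z) \<in> adj E ^^ ((LEAST n. (x, y) \<in> adj E ^^ n) + (LEAST n. (y, z) \<in> adj E ^^ n))"
      using short that by (auto simp: relpow_add)
    from Least_le[of "\<lambda>n. (x, z) \<in> adj E ^^ n", OF this] show ?thesis
      unfolding path_dist_def by linarith
  qed
qed

lemma Metric_space_MR: "Metric_space MR_verts MR_dist"
  unfolding MR_dist_def
proof (rule Metric_space_path_dist)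
  fix x y assume "x \<in> MR_verts" "y \<in> MR_verts"
  have sym: "sym ((adj MR_edges)\<^sup>*)"
    by (intro sym_rtrancl symI) (simp add: adj_def insert_commute)
  have pt: "(Origin, Point a) \<in> (adj MR_edges)\<^sup>*" if "1 \<le> a" for a
    using that by (intro r_into_rtrancl) (auto simp: adj_def MR_edges_def)
  have "(Origin, v) \<in> (adj MR_edges)\<^sup>*" if v: "v \<in> MR_verts" for v
  proof -
    consider "v = Origin" | a where "v = Point a" "1 \<le> a" | A where "v = Segment A" "A \<in> MR_F"
      using v unfolding MR_verts_def by blast
    then show ?thesis
    proof cases
      case 3
      then obtain a where a: "a \<in> A" "1 \<le> a" by (auto simp: MR_F_def)
      then have "(Point a, v) \<in> adj MR_edges" using 3 by (auto simp: adj_def MR_edges_def)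
      with pt[OF a(2)] show ?thesis by (rule rtrancl_into_rtrancl)
    qed (auto intro: pt)
  qed
  then show "(x, y) \<in> (adj MR_edges)\<^sup>*"
    using \<open>x \<in> MR_verts\<close> \<open>y \<in> MR_verts\<close> sym by (meson rtrancl_trans symD)
qed

end

theory Submission
  imports Defs
begin

text \<open>Both halves rest on what reflexivity says about a bounded sequence \<open>x\<^sub>1, x\<^sub>2, \<dots>\<close> of images of
  the points of the graph.

  For an embedding with constants \<open>C\<^sub>1, C\<^sub>2\<close> into a reflexive space, the sequence has a weak cluster
  point \<open>z\<close>. The image of \<open>[n + 1, \<infinity>)\<close> lies within \<open>C\<^sub>2\<close> of every \<open>x\<^sub>k\<close> with \<open>k > n\<close>, hence within \<open>C\<^sub>2\<close>
  of \<open>z\<close>. On the other hand \<open>z\<close> is a norm limit of convex combinations of the \<open>x\<^sub>k\<close> (Mazur); once \<open>n\<close>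
  is so large that some combination of \<open>x\<^sub>1, \<dots>, x\<^sub>n\<close> is \<open>\<epsilon>\<close>-close to \<open>z\<close>, the image of \<open>[1, n]\<close>,
  being within \<open>C\<^sub>2\<close> of each of these \<open>x\<^sub>k\<close>, lies within \<open>C\<^sub>2 + \<epsilon>\<close> of \<open>z\<close>. The two disjoint segments have
  distance 4, so \<open>4 C\<^sub>1 \<le> 2 C\<^sub>2 + \<epsilon>\<close>, which fails for small \<open>\<epsilon>\<close> if \<open>C\<^sub>2 / C\<^sub>1 < 2\<close>. This is
  \<open>MR_embedding_imp_nonreflexive\<close>.

  Conversely, a non-reflexive Banach space contains, by James, bounded sequences of vectors \<open>x\<^sub>k\<close> and
  functionals \<open>f\<^sub>n\<close> with \<open>f\<^sub>n x\<^sub>k = 1\<close> for \<open>n \<le> k\<close> and \<open>0\<close> otherwise (\<open>james_sequences\<close>). The functional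
  \<open>g\<^sub>n = f\<^sub>0 - 2 f\<^sub>n\<^sub>+\<^sub>1\<close> takes the value 1 at \<open>x\<^sub>0, \<dots>, x\<^sub>n\<close> and \<open>-1\<close> at all later \<open>x\<^sub>k\<close>. Send the point \<open>k\<close>
  to \<open>x\<^sub>k\<close>, the segment \<open>[1, j]\<close> to \<open>x\<^sub>j + x\<^sub>0\<close> and \<open>[j, \<infinity>)\<close> to \<open>x\<^sub>j - x\<^sub>0\<close>. In these coordinates \<open>g\<^sub>n\<close>
  is an explicit function \<open>cut n\<close> on the vertices. Each \<open>cut n\<close> is 1-Lipschitz, and every pair of
  vertices has its distance realised by some \<open>cut n\<close> (\<open>MR_dist_attained_by_cut\<close>), that is, the cuts
  embed the graph isometrically into \<open>\<ell>\<^sub>\<infinity>\<close>. So the norm \<open>sup\<^sub>n |g\<^sub>n y|\<close>, made equivalent to the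
  given one by taking the maximum with a small multiple of it, induces the graph distance.

  The functional analysis (Hahn--Banach separation, Helly's theorem, existence of weak cluster points)
  is derived from one source, the Mazur--Orlicz theorem on sublinear functionals.\<close>

section \<open>Sublinear functionals and the Hahn--Banach theorem\<close>

definition sublinear :: "('a::real_vector \<Rightarrow> real) \<Rightarrow> bool" where
  "sublinear p \<longleftrightarrow> (\<forall>x y. p (x + y) \<le> p x + p y) \<and> (\<forall>t x. 0 \<le> t \<longrightarrow> p (t *\<^sub>R x) = t * p x)"

lemma sublinear_add: "sublinear p \<Longrightarrow> p (x + y) \<le> p x + p y"
  by (simp add: sublinear_def)

lemma sublinear_scale: "sublinear p \<Longrightarrow> 0 \<le> t \<Longrightarrow> p (t *\<^sub>R x) = t * p x"
  by (simp add: sublinear_def)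

lemma sublinear_zero: "sublinear p \<Longrightarrow> p 0 = 0"
  using sublinear_scale[of p 0 0] by simp

lemma sublinear_neg_ge: "sublinear p \<Longrightarrow> - p (- x) \<le> p x"
  using sublinear_add[of p x "- x"] sublinear_zero[of p] by simp

lemma sublinear_norm: "sublinear (norm :: 'a::real_normed_vector \<Rightarrow> real)"
  by (simp add: sublinear_def norm_triangle_ineq)

text \<open>Sublinear functionals are constructed below as the lower envelope of a convex cone of pairs \<open>(v, r)\<close>,
  given as a relation \<open>R v r\<close>. The cone must contain no \<open>(0, r)\<close> with \<open>r < 0\<close>: adding \<open>(v, r)\<close> and
  \<open>(- v, s)\<close> then gives \<open>r \<ge> - s\<close>, so the envelope is finite.\<close>

lemma sublinear_Inf:
  fixes R :: "'a::real_vector \<Rightarrow> real \<Rightarrow> bool"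
  assumes add: "\<And>v w r s. R v r \<Longrightarrow> R w s \<Longrightarrow> R (v + w) (r + s)"
    and scale: "\<And>t v r. 0 < t \<Longrightarrow> R v r \<Longrightarrow> R (t *\<^sub>R v) (t * r)"
    and zero: "R 0 0" and pos: "\<And>r. R 0 r \<Longrightarrow> 0 \<le> r"
    and ex: "\<And>v. \<exists>r. R v r"
  shows "sublinear (\<lambda>v. Inf {r. R v r})" and "R v r \<Longrightarrow> Inf {r. R v r} \<le> r"
proof -
  define p where "p v = Inf {r. R v r}" for v
  have bdd: "bdd_below {r. R v r}" for v
  proof -
    obtain s where s: "R (- v) s" using ex by blast
    have "- s \<le> r" if "R v r" for r
      using pos[of "r + s"] add[OF that s] by simp
    then show ?thesis by (auto simp: bdd_below_def)
  qed
  have le: "p v \<le> r" if "R v r" for v r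
    unfolding p_def using that bdd by (intro cInf_lower) auto
  then show "R v r \<Longrightarrow> Inf {r. R v r} \<le> r" by (simp add: p_def)
  have ge: "b \<le> p v" if "\<And>r. R v r \<Longrightarrow> b \<le> r" for b v
    unfolding p_def using that ex[of v] by (intro cInf_greatest) auto
  have subadd: "p (v + w) \<le> p v + p w" for v w
  proof -
    have "p (v + w) - s \<le> p v" if "R w s" for s
      using le[OF add[OF _ that]] by (intro ge) (simp add: algebra_simps)
    then have "p (v + w) - p v \<le> p w" by (intro ge) (simp add: algebra_simps)
    then show ?thesis by simp
  qed
  have scale_le: "p (t *\<^sub>R v) \<le> t * p v" if t: "0 < t" for t v
  proof -
    have "p (t *\<^sub>R v) / t \<le> p v"
      using le[OF scale[OF t]] t by (intro ge) (simp add: divide_simps mult.commute)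
    then show ?thesis using t by (simp add: divide_simps mult.commute)
  qed
  have p0: "p 0 = 0" using le[OF zero] ge[of 0 0] pos by force
  have "p (t *\<^sub>R v) = t * p v" if t: "0 \<le> t" for t v
  proof (cases "t = 0")
    case False
    then have "p v \<le> (1 / t) * p (t *\<^sub>R v)"
      using scale_le[of "1 / t" "t *\<^sub>R v"] t by simp
    then show ?thesis using scale_le[of t v] t False by (simp add: divide_simps mult.commute)
  qed (simp add: p0)
  then show "sublinear (\<lambda>v. Inf {r. R v r})"
    using subadd by (simp add: sublinear_def p_def)
qed

text \<open>The witness is \<open>q v = inf {p (v + t c) - t \<delta> | t \<ge> 0, c \<in> C}\<close>: taking \<open>t = 0\<close> gives \<open>q \<le> p\<close>, and
  \<open>v = - c\<close>, \<open>t = 1\<close> gives \<open>q (- c) \<le> - \<delta>\<close>. Any linear functional below \<open>q\<close> is then at least \<open>\<delta>\<close>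
  on \<open>C\<close>. The lemma is used a second time, for a single point, to show that minimal sublinear functionals
  are linear.\<close>

lemma sublinear_lower_on_convex:
  assumes p: "sublinear p" and C: "convex C" "C \<noteq> {}" and \<delta>: "\<And>c. c \<in> C \<Longrightarrow> \<delta> \<le> p c"
  shows "\<exists>q. sublinear q \<and> q \<le> p \<and> (\<forall>c\<in>C. q (- c) \<le> - \<delta>)"
proof -
  define R where "R v r \<longleftrightarrow> (\<exists>t\<ge>0. \<exists>c\<in>C. p (v + t *\<^sub>R c) - t * \<delta> \<le> r)" for v r
  have add: "R (v + w) (r + s)" if vr: "R v r" and ws: "R w s" for v w r s
  proof -
    from vr obtain t c where t: "0 \<le> t" "c \<in> C" "p (v + t *\<^sub>R c) - t * \<delta> \<le> r"
      by (auto simp: R_def)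
    from ws obtain u d where u: "0 \<le> u" "d \<in> C" "p (w + u *\<^sub>R d) - u * \<delta> \<le> s"
      by (auto simp: R_def)
    \<comment> \<open>convexity turns the two multiples of points of \<open>C\<close> into one\<close>
    obtain e where e: "e \<in> C" "(t + u) *\<^sub>R e = t *\<^sub>R c + u *\<^sub>R d"
    proof (cases "t + u = 0")
      case True
      then have "t = 0" "u = 0" using t u by auto
      then show ?thesis using that t by simp
    next
      case False
      define e where "e = (t / (t + u)) *\<^sub>R c + (u / (t + u)) *\<^sub>R d"
      have "e \<in> C" unfolding e_def using False t u
        by (intro convexD[OF C(1)]) (auto simp: add_divide_distrib[symmetric])
      moreover have "(t + u) *\<^sub>R e = t *\<^sub>R c + u *\<^sub>R d"
        using False by (simp add: e_def scaleR_add_right)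
      ultimately show ?thesis using that by blast
    qed
    have "p (v + w + (t + u) *\<^sub>R e) \<le> p (v + t *\<^sub>R c) + p (w + u *\<^sub>R d)"
      using sublinear_add[OF p, of "v + t *\<^sub>R c" "w + u *\<^sub>R d"] by (simp add: e(2) ac_simps)
    then have "p (v + w + (t + u) *\<^sub>R e) - (t + u) * \<delta> \<le> r + s"
      using t u by (simp add: algebra_simps)
    then show ?thesis unfolding R_def using t(1) u(1) e(1) by (metis add_nonneg_nonneg)
  qed
  have scale: "R (a *\<^sub>R v) (a * r)" if a: "0 < a" and vr: "R v r" for a v r
  proof -
    from vr obtain t c where t: "0 \<le> t" "c \<in> C" "p (v + t *\<^sub>R c) - t * \<delta> \<le> r"
      by (auto simp: R_def)
    have "p (a *\<^sub>R v + (a * t) *\<^sub>R c) = a * p (v + t *\<^sub>R c)"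
      using sublinear_scale[OF p, of a "v + t *\<^sub>R c"] a by (simp add: scaleR_add_right)
    then have "p (a *\<^sub>R v + (a * t) *\<^sub>R c) - (a * t) * \<delta> = a * (p (v + t *\<^sub>R c) - t * \<delta>)"
      by (simp add: algebra_simps)
    also have "\<dots> \<le> a * r" using t(3) a by (intro mult_left_mono) auto
    finally show ?thesis unfolding R_def using a t by (meson less_imp_le mult_nonneg_nonneg)
  qed
  have Rp: "R v (p v)" for v
    using C(2) by (auto simp: R_def intro!: exI[of _ 0])
  have pos: "0 \<le> r" if R: "R 0 r" for r
  proof -
    from R obtain t c where t: "0 \<le> t" "c \<in> C" "p (0 + t *\<^sub>R c) - t * \<delta> \<le> r"
      unfolding R_def by blast
    then have "t * (p c - \<delta>) \<le> r" by (simp add: sublinear_scale[OF p] algebra_simps)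
    moreover have "0 \<le> t * (p c - \<delta>)" using t \<delta>[of c] by simp
    ultimately show ?thesis by simp
  qed
  have R0: "R 0 0" using Rp[of 0] sublinear_zero[OF p] by simp
  have Rc: "R (- c) (- \<delta>)" if "c \<in> C" for c
    using that sublinear_zero[OF p] by (auto simp: R_def intro!: exI[of _ 1] bexI[of _ c])
  have ex: "\<exists>r. R v r" for v using Rp by blast
  have q1: "sublinear (\<lambda>v. Inf {r. R v r})"
    using add scale R0 pos ex by (rule sublinear_Inf)
  have q2: "Inf {r. R v r} \<le> r" if "R v r" for v r
    using add scale R0 pos ex that by (rule sublinear_Inf)
  show ?thesis
    using q1 q2[OF Rp] q2[OF Rc] by (intro exI[of _ "\<lambda>v. Inf {r. R v r}"]) (auto simp: le_fun_def)
qed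

text \<open>By Zorn's lemma, since the pointwise infimum of a chain of sublinear functionals below \<open>p\<close> is again
  sublinear.\<close>

lemma minimal_sublinear_exists:
  fixes p :: "'a::real_vector \<Rightarrow> real"
  assumes p: "sublinear p"
  shows "\<exists>f\<le>p. sublinear f \<and> (\<forall>q. sublinear q \<longrightarrow> q \<le> f \<longrightarrow> q = f)"
proof -
  define A where "A = {q. sublinear q \<and> q \<le> p}"
  have "\<exists>m\<in>A. \<forall>a\<in>A. a \<le> m \<longrightarrow> a = m"
  proof (rule predicate_Zorn)
    show "partial_order_on A (relation_of (\<lambda>a b. b \<le> a) A)"
      by (rule partial_order_on_relation_ofI) auto
  next
    fix K assume K: "K \<in> Chains (relation_of (\<lambda>a b. b \<le> a) A)"
    have KA: "K \<subseteq> A" using K by (rule Chains_relation_of)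
    have lin: "a \<le> b \<or> b \<le> a" if "a \<in> K" "b \<in> K" for a b
      using K that by (auto simp: Chains_def relation_of_def)
    show "\<exists>u\<in>A. \<forall>a\<in>K. u \<le> a"
    proof (cases "K = {}")
      case True
      then show ?thesis using p by (auto simp: A_def)
    next
      case False
      define R where "R v r \<longleftrightarrow> (\<exists>q\<in>K. q v \<le> r)" for v r
      have sub: "sublinear q" if "q \<in> K" for q using that KA by (auto simp: A_def)
      have add: "R (v + w) (r + s)" if vr: "R v r" and ws: "R w s" for v w r s
      proof -
        from vr ws obtain q1 q2 where q: "q1 \<in> K" "q1 v \<le> r" "q2 \<in> K" "q2 w \<le> s"
          by (auto simp: R_def)
        then obtain q where q': "q \<in> K" "q \<le> q1" "q \<le> q2" using lin by blast
        have "q (v + w) \<le> q v + q w" by (rule sublinear_add[OF sub[OF q'(1)]])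
        also have "\<dots> \<le> q1 v + q2 w" using q' by (intro add_mono) (auto simp: le_fun_def)
        also have "\<dots> \<le> r + s" using q by simp
        finally show ?thesis using q'(1) by (auto simp: R_def)
      qed
      have scale: "R (t *\<^sub>R v) (t * r)" if "0 < t" "R v r" for t v r
        using that by (force simp: R_def sublinear_scale[OF sub])
      have R0: "R 0 0" using False by (auto simp: R_def sublinear_zero[OF sub])
      have pos: "0 \<le> r" if "R 0 r" for r
        using that by (auto simp: R_def sublinear_zero[OF sub])
      have Rq: "R v (q v)" if "q \<in> K" for q v using that by (auto simp: R_def)
      have ex: "\<exists>r. R v r" for v using False Rq by blast
      have u: "sublinear (\<lambda>v. Inf {r. R v r})"
        using add scale R0 pos ex by (rule sublinear_Inf)
      have "Inf {r. R v r} \<le> r" if "R v r" for v r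
        using add scale R0 pos ex that by (rule sublinear_Inf)
      then have le: "(\<lambda>v. Inf {r. R v r}) \<le> q" if "q \<in> K" for q
        using Rq[OF that] by (auto simp: le_fun_def)
      moreover have "(\<lambda>v. Inf {r. R v r}) \<in> A"
        using False KA le u unfolding A_def by (blast intro: order_trans)
      ultimately show ?thesis by blast
    qed
  qed
  then obtain f where f: "f \<in> A" "\<And>a. a \<in> A \<Longrightarrow> a \<le> f \<Longrightarrow> a = f" by blast
  have "q = f" if "sublinear q" "q \<le> f" for q
    using f that by (auto simp: A_def intro: order_trans)
  then show ?thesis using f(1) by (auto simp: A_def)
qed

text \<open>Lowering \<open>f\<close> on the convex set \<open>{x}\<close> as far as its own value \<open>f x\<close> permits yields a functional with
  value at most \<open>- f x\<close> at \<open>- x\<close>; by minimality this functional is \<open>f\<close>, so \<open>f\<close> is odd. Odd sublinear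
  functionals are linear.\<close>

lemma minimal_sublinear_linear:
  assumes f: "sublinear f" and min: "\<And>q. sublinear q \<Longrightarrow> q \<le> f \<Longrightarrow> q = f"
  shows "linear f"
proof -
  have neg: "f (- x) = - f x" for x
  proof -
    obtain q where "sublinear q" "q \<le> f" "q (- x) \<le> - f x"
      using sublinear_lower_on_convex[OF f, of "{x}" "f x"] by auto
    then have "f (- x) \<le> - f x" using min by blast
    then show ?thesis using sublinear_neg_ge[OF f, of x] by simp
  qed
  have "f (x + y) = f x + f y" for x y
    using sublinear_add[OF f, of x y] sublinear_add[OF f, of "- x" "- y"]
      neg[of "x + y"] neg[of x] neg[of y]
    by simp
  moreover have "f (t *\<^sub>R x) = t *\<^sub>R f x" for t x
  proof (cases "0 \<le> t")
    case False
    then have "f (t *\<^sub>R x) = - f ((- t) *\<^sub>R x)" using neg[of "t *\<^sub>R x"] by simp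
    then show ?thesis using False sublinear_scale[OF f, of "- t" x] by simp
  qed (simp add: sublinear_scale[OF f])
  ultimately show ?thesis by (intro linearI) auto
qed

text \<open>The case \<open>C = {0}\<close>, \<open>\<delta> = 0\<close> is the existence of a linear functional below \<open>p\<close>; the general
  case contains the separation theorem.\<close>

theorem mazur_orlicz:
  fixes p :: "'a::real_vector \<Rightarrow> real"
  assumes p: "sublinear p" and C: "convex C" "C \<noteq> {}" and \<delta>: "\<And>c. c \<in> C \<Longrightarrow> \<delta> \<le> p c"
  shows "\<exists>f. linear f \<and> f \<le> p \<and> (\<forall>c\<in>C. \<delta> \<le> f c)"
proof -
  obtain q where q: "sublinear q" "q \<le> p" "\<And>c. c \<in> C \<Longrightarrow> q (- c) \<le> - \<delta>"
    using sublinear_lower_on_convex[OF p C \<delta>] by blast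
  obtain f where f: "f \<le> q" "sublinear f" "\<And>q. sublinear q \<Longrightarrow> q \<le> f \<Longrightarrow> q = f"
    using minimal_sublinear_exists[OF q(1)] by blast
  have lin: "linear f" by (rule minimal_sublinear_linear[OF f(2,3)])
  have "\<delta> \<le> f c" if "c \<in> C" for c
    using linear_neg[OF lin, of c] q(3)[OF that] f(1) by (force simp: le_fun_def dest: spec[of _ "- c"])
  then show ?thesis using lin f(1) q(2) by (meson order_trans)
qed

lemma bounded_linear_functionalI:
  fixes f :: "'a::real_normed_vector \<Rightarrow> real"
  assumes lin: "linear f" and le: "\<And>x. f x \<le> K * norm x"
  shows "bounded_linear f" and "\<bar>f x\<bar> \<le> K * norm x"
proof -
  have *: "\<bar>f x\<bar> \<le> K * norm x" for x
    using le[of x] le[of "- x"] linear_neg[OF lin, of x] by auto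
  then show "\<bar>f x\<bar> \<le> K * norm x" .
  show "bounded_linear f"
    using * by (intro bounded_linear_intro[of _ K])
      (auto simp: linear_add[OF lin] linear_scale[OF lin] mult.commute)
qed

text \<open>The Mazur--Orlicz theorem for the norm: a convex set outside the open ball of radius \<open>\<delta>\<close> is separated
  from it with the sharp constant.\<close>

lemma separate_convex_from_ball:
  fixes C :: "'a::real_normed_vector set"
  assumes C: "convex C" "C \<noteq> {}" and \<delta>: "\<And>c. c \<in> C \<Longrightarrow> \<delta> \<le> norm c"
  shows "\<exists>f :: 'a \<Rightarrow>\<^sub>L real. norm f \<le> 1 \<and> (\<forall>c\<in>C. \<delta> \<le> blinfun_apply f c)"
proof -
  obtain f :: "'a \<Rightarrow> real" where f: "linear f" "f \<le> norm" "\<forall>c\<in>C. \<delta> \<le> f c"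
    using mazur_orlicz[OF sublinear_norm C \<delta>] by blast
  have le: "f x \<le> 1 * norm x" for x using f(2) by (simp add: le_fun_def)
  note bl = bounded_linear_functionalI[OF f(1) le]
  have "norm (Blinfun f) \<le> 1"
    using bl(2) by (intro norm_blinfun_bound) (auto simp: bounded_linear_Blinfun_apply[OF bl(1)])
  then show ?thesis
    using f(3) by (intro exI[of _ "Blinfun f"]) (simp add: bounded_linear_Blinfun_apply[OF bl(1)])
qed

lemma norming_functional:
  fixes x :: "'a::real_normed_vector"
  shows "\<exists>f :: 'a \<Rightarrow>\<^sub>L real. norm f \<le> 1 \<and> norm x \<le> blinfun_apply f x"
  using separate_convex_from_ball[of "{x}" "norm x"] by simp

lemma functional_le_norm:
  fixes f :: "'a::real_normed_vector \<Rightarrow>\<^sub>L real"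
  assumes "norm f \<le> 1" shows "f x \<le> norm x"
  using norm_blinfun[of f x] mult_right_mono[OF assms, of "norm x"] by auto

text \<open>A nonzero value could be scaled to any real number, in particular to \<open>b - 1\<close>.\<close>

lemma linear_bounded_below_on_subspace:
  fixes f :: "'a::real_vector \<Rightarrow> real"
  assumes f: "linear f" and S: "subspace S" and b: "\<And>x. x \<in> S \<Longrightarrow> b \<le> f x" and x: "x \<in> S"
  shows "f x = 0"
proof (rule ccontr)
  assume "f x \<noteq> 0"
  then show False
    using b[OF subspace_scale[OF S x, of "(b - 1) / f x"]] by (simp add: linear_scale[OF f])
qed

section \<open>Helly's theorem\<close>

definition common_kernel :: "('a::real_normed_vector \<Rightarrow>\<^sub>L real) set \<Rightarrow> 'a set" where
  "common_kernel S = {x. \<forall>g\<in>S. blinfun_apply g x = 0}"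

lemma subspace_common_kernel: "subspace (common_kernel S)"
  by (auto simp: common_kernel_def subspace_def blinfun.bilinear_simps)

text \<open>Induction on \<open>S\<close>: if \<open>f\<close> is not already zero on the kernel of the others, pick \<open>z\<close> there with
  \<open>f z \<noteq> 0\<close> and subtract from \<open>g\<close> the multiple of \<open>f\<close> that makes it vanish at \<open>z\<close>.\<close>

lemma in_span_if_common_kernel:
  fixes g :: "'a::real_normed_vector \<Rightarrow>\<^sub>L real"
  assumes "finite S" and "\<And>x. x \<in> common_kernel S \<Longrightarrow> g x = 0"
  shows "g \<in> span S"
  using assms
proof (induction S arbitrary: g rule: finite_induct)
  case empty
  then have "g = 0" by (intro blinfun_eqI) (simp add: common_kernel_def)
  then show ?case by simp
next
  case (insert f S)
  show ?case
  proof (cases "\<forall>x\<in>common_kernel S. f x = 0")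
    case True
    then have "g \<in> span S"
      using insert.prems by (intro insert.IH) (auto simp: common_kernel_def)
    then show ?thesis by (meson span_mono subset_insertI subsetD)
  next
    case False
    then obtain z where z: "z \<in> common_kernel S" "f z \<noteq> 0" by blast
    define h where "h = g - (g z / f z) *\<^sub>R f"
    have "h x = 0" if x: "x \<in> common_kernel S" for x
    proof -
      have "x - (f x / f z) *\<^sub>R z \<in> common_kernel (insert f S)"
        using x z by (auto simp: common_kernel_def blinfun.bilinear_simps)
      from insert.prems[OF this] show ?thesis
        using z by (simp add: h_def blinfun.bilinear_simps field_simps)
    qed
    then have "h \<in> span S" by (rule insert.IH)
    then have "h \<in> span (insert f S)" by (meson span_mono subset_insertI subsetD)
    moreover have "g = h + (g z / f z) *\<^sub>R f" by (simp add: h_def)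
    ultimately show ?thesis by (metis insertI1 span_add span_base span_scale)
  qed
qed

lemma eq_on_span:
  fixes \<Phi> :: "('a::real_normed_vector \<Rightarrow>\<^sub>L real) \<Rightarrow>\<^sub>L real"
  assumes "\<And>g. g \<in> S \<Longrightarrow> blinfun_apply g y = \<Phi> g" and "g \<in> span S"
  shows "blinfun_apply g y = \<Phi> g"
  using assms(2) by (induction rule: span_induct_alt) (auto simp: assms(1) blinfun.bilinear_simps)

text \<open>Only consistency matters here: a functional in the span of the earlier ones is handled by linearity,
  and any other one can be adjusted along a vector on which the earlier ones vanish. The bound on the
  norm of \<open>y\<close> comes with Helly's theorem.\<close>

lemma interpolate_bidual:
  fixes \<Phi> :: "('a::real_normed_vector \<Rightarrow>\<^sub>L real) \<Rightarrow>\<^sub>L real"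
  assumes "finite S"
  shows "\<exists>y. \<forall>g\<in>S. blinfun_apply g y = \<Phi> g"
  using assms
proof (induction S rule: finite_induct)
  case (insert g S)
  then obtain y where y: "\<And>h. h \<in> S \<Longrightarrow> blinfun_apply h y = \<Phi> h" by blast
  show ?case
  proof (cases "g \<in> span S")
    case True
    then show ?thesis using y eq_on_span[OF y] by blast
  next
    case False
    then obtain z where z: "z \<in> common_kernel S" "g z \<noteq> 0"
      using in_span_if_common_kernel[OF insert.hyps(1)] by blast
    have "\<forall>h\<in>insert g S. blinfun_apply h (y + ((\<Phi> g - g y) / blinfun_apply g z) *\<^sub>R z) = \<Phi> h"
      using y z by (auto simp: common_kernel_def blinfun.bilinear_simps)
    then show ?thesis by blast
  qed
qed simp

text \<open>The solutions of the finite system form a translate of the common kernel of \<open>S\<close>. If they all had norm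
  at least \<open>M\<close>, a functional \<open>f\<close> of norm at most 1 would be at least \<open>M\<close> on them. Being bounded below
  on the translate, \<open>f\<close> vanishes on the common kernel, so it is a combination of elements of \<open>S\<close>, and
  its value at a solution is \<open>\<Phi> f \<le> norm \<Phi> < M\<close>.\<close>

theorem helly:
  fixes \<Phi> :: "('a::real_normed_vector \<Rightarrow>\<^sub>L real) \<Rightarrow>\<^sub>L real"
  assumes S: "finite S" and M: "norm \<Phi> < M"
  shows "\<exists>y. norm y \<le> M \<and> (\<forall>g\<in>S. blinfun_apply g y = \<Phi> g)"
proof (rule ccontr)
  assume neg: "\<not> ?thesis"
  define C where "C = {y. \<forall>g\<in>S. blinfun_apply g y = \<Phi> g}"
  obtain y0 where y0: "y0 \<in> C" using interpolate_bidual[OF S, of \<Phi>] by (auto simp: C_def)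
  have "convex C"
  proof (rule convexI)
    fix y z u v assume "y \<in> C" "z \<in> C" "0 \<le> u" "0 \<le> v" "u + v = (1::real)"
    moreover have "u * \<Phi> g + v * \<Phi> g = \<Phi> g" for g
      using \<open>u + v = 1\<close> by (metis distrib_right mult_1)
    ultimately show "u *\<^sub>R y + v *\<^sub>R z \<in> C"
      by (simp add: C_def blinfun.add_right blinfun.scaleR_right)
  qed
  moreover have "M \<le> norm c" if "c \<in> C" for c using neg that by (force simp: C_def)
  ultimately obtain f :: "'a \<Rightarrow>\<^sub>L real" where f: "norm f \<le> 1" "\<And>c. c \<in> C \<Longrightarrow> M \<le> blinfun_apply f c"
    using separate_convex_from_ball[of C M] y0 by blast
  have "f w = 0" if w: "w \<in> common_kernel S" for w
  proof (rule linear_bounded_below_on_subspace[OF _ subspace_common_kernel _ w])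
    show "linear f" by (simp add: blinfun.bounded_linear_right bounded_linear.linear)
    fix x assume "x \<in> common_kernel S"
    then have "y0 + x \<in> C" using y0 by (auto simp: C_def common_kernel_def blinfun.bilinear_simps)
    from f(2)[OF this] show "M - f y0 \<le> f x" by (simp add: blinfun.bilinear_simps)
  qed
  then have "f \<in> span S" by (rule in_span_if_common_kernel[OF S])
  then have "f y0 = \<Phi> f" by (rule eq_on_span[rotated]) (use y0 in \<open>auto simp: C_def\<close>)
  also have "\<dots> \<le> norm \<Phi>"
    using norm_blinfun[of \<Phi> f] mult_left_mono[OF f(1), of "norm \<Phi>"] by simp
  finally show False using f(2)[OF y0] M by simp
qed

section \<open>Non-reflexive spaces\<close>

lemma bounded_linear_canonical_embedding: "bounded_linear canonical_embedding"
  unfolding canonical_embedding_def by (rule blinfun.bounded_linear_prod_left)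

lemma norm_le_norm_canonical_embedding: "norm x \<le> norm (canonical_embedding x)"
proof -
  obtain f :: "'a \<Rightarrow>\<^sub>L real" where f: "norm f \<le> 1" "norm x \<le> blinfun_apply f x"
    using norming_functional by blast
  have "f x \<le> norm (canonical_embedding x) * norm f"
    using norm_blinfun[of "canonical_embedding x" f] by simp
  then show ?thesis using f mult_left_mono[OF f(1), of "norm (canonical_embedding x)"] by simp
qed

text \<open>An isometric image of a complete space is complete; this is where the Banach property enters.\<close>

lemma closed_range_canonical_embedding:
  "closed (range (canonical_embedding :: 'a::banach \<Rightarrow> _))"
proof (rule complete_imp_closed)
  show "complete (range (canonical_embedding :: 'a \<Rightarrow> _))"
    by (rule complete_isometric_image[of 1])
      (auto simp: norm_le_norm_canonical_embedding bounded_linear_canonical_embedding complete_UNIV)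
qed

text \<open>\<open>\<Phi>\<close> is any element of the bidual that is not an evaluation, and \<open>\<Lambda>\<close> separates it from the closed
  subspace of all evaluations.\<close>

lemma nonreflexive_separation:
  fixes X :: "'a::banach itself"
  assumes "\<not> reflexive_space X"
  obtains \<Phi> :: "('a \<Rightarrow>\<^sub>L real) \<Rightarrow>\<^sub>L real" and \<Lambda> :: "(('a \<Rightarrow>\<^sub>L real) \<Rightarrow>\<^sub>L real) \<Rightarrow>\<^sub>L real"
  where "blinfun_apply \<Lambda> \<Phi> = 1" and "\<And>x. blinfun_apply \<Lambda> (canonical_embedding x) = 0"
proof -
  let ?J = "canonical_embedding :: 'a \<Rightarrow> _"
  obtain \<Phi> where \<Phi>: "\<Phi> \<notin> range ?J" using assms by (auto simp: reflexive_space_def)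
  have "open (- range ?J)" using closed_range_canonical_embedding by (simp add: closed_def)
  then obtain \<delta> where \<delta>: "0 < \<delta>" "\<And>y. dist y \<Phi> < \<delta> \<Longrightarrow> y \<in> - range ?J"
    using \<Phi> unfolding open_dist by (metis ComplI)
  have far: "\<delta> \<le> dist \<Phi> (?J x)" for x
    using \<delta>(2)[of "?J x"] by (metis ComplD dist_commute not_less rangeI)
  interpret J: bounded_linear ?J by (rule bounded_linear_canonical_embedding)
  have sub: "subspace (range ?J)" by (simp add: J.linear_axioms linear_subspace_image)
  have "convex ((\<lambda>x. \<Phi> + x) ` range ?J)"
    using subspace_imp_convex[OF sub] by (rule convex_translation)
  moreover have "\<delta> \<le> norm c" if "c \<in> (\<lambda>x. \<Phi> + x) ` range ?J" for c
    using that far[of "- x" for x] by (auto simp: dist_norm J.neg)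
  ultimately obtain F :: "(('a \<Rightarrow>\<^sub>L real) \<Rightarrow>\<^sub>L real) \<Rightarrow>\<^sub>L real"
    where F: "\<And>x. \<delta> \<le> blinfun_apply F (\<Phi> + ?J x)"
    using separate_convex_from_ball[of "(\<lambda>x. \<Phi> + x) ` range ?J" \<delta>] by auto
  have FJ: "F v = 0" if "v \<in> range ?J" for v
  proof (rule linear_bounded_below_on_subspace[OF _ sub _ that])
    show "linear F" by (simp add: blinfun.bounded_linear_right bounded_linear.linear)
    show "\<delta> - F \<Phi> \<le> F w" if "w \<in> range ?J" for w
      using that F by (auto simp: blinfun.bilinear_simps algebra_simps)
  qed
  have "0 < F \<Phi>" using F[of 0] \<delta>(1) by (simp add: J.zero)
  then show ?thesis
    using FJ by (intro that[of "(1 / F \<Phi>) *\<^sub>R F" \<Phi>]) (auto simp: blinfun.bilinear_simps)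
qed

text \<open>Let \<open>\<Phi>\<close> and \<open>\<Lambda>\<close> be as in the preceding lemma. The pairs \<open>(f\<^sub>n, x\<^sub>n)\<close> are chosen recursively, keeping
  \<open>\<Phi> f\<^sub>n = 1\<close>. Helly's theorem is used alternately at two levels: the functional \<open>f\<^sub>n\<close> imitates \<open>\<Lambda>\<close> on
  \<open>\<Phi>\<close> and on the evaluations at the earlier vectors, so it kills those vectors; the vector \<open>x\<^sub>n\<close> imitates \<open>\<Phi>\<close>
  on all functionals chosen so far, so they take the value 1 at it. The bounds depend only on the norms
  of \<open>\<Phi>\<close> and \<open>\<Lambda>\<close>.\<close>

theorem james_sequences:
  fixes X :: "'a::banach itself"
  assumes "\<not> reflexive_space X"
  obtains f :: "nat \<Rightarrow> 'a \<Rightarrow>\<^sub>L real" and x :: "nat \<Rightarrow> 'a" and M :: real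
  where "0 < M" and "\<And>n. norm (f n) \<le> M" and "\<And>k. norm (x k) \<le> M"
    and "\<And>n k. blinfun_apply (f n) (x k) = (if n \<le> k then 1 else 0)"
proof -
  obtain \<Phi> :: "('a \<Rightarrow>\<^sub>L real) \<Rightarrow>\<^sub>L real" and \<Lambda> :: "(('a \<Rightarrow>\<^sub>L real) \<Rightarrow>\<^sub>L real) \<Rightarrow>\<^sub>L real"
    where \<Lambda>: "blinfun_apply \<Lambda> \<Phi> = 1" "\<And>x. blinfun_apply \<Lambda> (canonical_embedding x) = 0"
    using nonreflexive_separation[OF assms] by blast
  define M where "M = max (norm \<Phi>) (norm \<Lambda>) + 1"
  have M: "norm \<Phi> < M" "norm \<Lambda> < M" by (auto simp: M_def)
  have M0: "0 < M" using M(1) norm_ge_zero[of \<Phi>] by linarith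
  define P where "P s n r \<longleftrightarrow> norm (fst r) \<le> M \<and> norm (snd r) \<le> M \<and> \<Phi> (fst r) = 1 \<and>
      (\<forall>k<n. fst r (snd (s k)) = 0) \<and> fst r (snd r) = 1 \<and> (\<forall>i<n. fst (s i) (snd r) = 1)"
    for s :: "nat \<Rightarrow> ('a \<Rightarrow>\<^sub>L real) \<times> 'a" and n r
  have "\<exists>s. \<forall>n. P s n (s n)"
  proof (rule dependent_wellorder_choice)
    show "P f n r = P g n r" if "\<And>y. y < n \<Longrightarrow> f y = g y" for f g n r
      using that by (simp add: P_def)
    fix n :: nat and s assume IH: "\<And>y. y < n \<Longrightarrow> P s y (s y)"
    obtain f where f: "norm f \<le> M"
      "\<forall>G\<in>insert \<Phi> ((\<lambda>k. canonical_embedding (snd (s k))) ` {..<n}). blinfun_apply G f = \<Lambda> G"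
      using helly[OF _ M(2)] by (metis finite_imageI finite_insert finite_lessThan)
    obtain x where x: "norm x \<le> M" "\<forall>g\<in>insert f ((\<lambda>i. fst (s i)) ` {..<n}). blinfun_apply g x = \<Phi> g"
      using helly[OF _ M(1)] by (metis finite_imageI finite_insert finite_lessThan)
    have "P s n (f, x)"
      using f x IH by (auto simp: P_def \<Lambda>)
    then show "\<exists>r. P s n r" by blast
  qed
  then obtain s where s: "\<And>n. P s n (s n)" by blast
  have "fst (s n) (snd (s k)) = (if n \<le> k then 1 else 0)" for n k
    using s[of n] s[of k] by (cases n k rule: linorder_cases) (auto simp: P_def)
  then show ?thesis
    using s M0 by (intro that[of M "\<lambda>n. fst (s n)" "\<lambda>n. snd (s n)"]) (auto simp: P_def)
qed

section \<open>The distance of the graph as a supremum of cuts\<close>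

text \<open>The \<open>n\<close>-th coordinate of an isometric embedding of the graph into \<open>\<ell>\<^sub>\<infinity>\<close>. It separates the points up
  to \<open>n\<close> from the later ones. Finite segments are the initial ones, and cofinite segments the final ones;
  the case \<open>n = 0\<close>, which puts all points on the same side, is needed for the distance 2 between the
  origin and \<open>[1, \<infinity>)\<close>.\<close>

fun cut :: "nat \<Rightarrow> vertex \<Rightarrow> real" where
  "cut n Origin = 0"
| "cut n (Point k) = (if k \<le> n then 1 else - 1)"
| "cut n (Segment A) =
    (if finite A then (if A \<subseteq> {1..n} then 2 else 0) else (if A \<inter> {1..n} = {} then - 2 else 0))"

lemma cut_initial: "1 \<le> j \<Longrightarrow> cut n (Segment {1..j}) = (if j \<le> n then 2 else 0)"
  by auto

lemma cut_final: "1 \<le> j \<Longrightarrow> cut n (Segment {j..}) = (if n < j then - 2 else 0)"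
  by (auto simp: infinite_Ici disjoint_iff)

lemma MR_F_cases:
  assumes "A \<in> MR_F"
  obtains (initial) j where "A = {1..j}" "1 \<le> j" | (final) j where "A = {j..}" "1 \<le> j"
  using assms by (auto simp: MR_F_def)

lemma MR_verts_cases:
  assumes "v \<in> MR_verts"
  obtains (origin) "v = Origin" | (point) k where "v = Point k" "1 \<le> k"
    | (initial) j where "v = Segment {1..j}" "1 \<le> j" | (final) j where "v = Segment {j..}" "1 \<le> j"
proof -
  consider "v = Origin" | k where "v = Point k" "1 \<le> k" | A where "v = Segment A" "A \<in> MR_F"
    using assms unfolding MR_verts_def by blast
  then show ?thesis
    by cases (use that MR_F_cases in \<open>metis+\<close>)
qed

lemma MR_verts_simps:
  "Origin \<in> MR_verts" "Point k \<in> MR_verts \<longleftrightarrow> 1 \<le> k" "Segment A \<in> MR_verts \<longleftrightarrow> A \<in> MR_F"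
  by (auto simp: MR_verts_def)

lemma MR_F_intros: "1 \<le> j \<Longrightarrow> {1..j} \<in> MR_F" "1 \<le> j \<Longrightarrow> {j..} \<in> MR_F"
  by (auto simp: MR_F_def)

lemma adj_MR_cases:
  assumes "(v, w) \<in> adj MR_edges"
  obtains (origin) k where "{v, w} = {Origin, Point k}" "1 \<le> k"
    | (segment) k A where "{v, w} = {Point k, Segment A}" "1 \<le> k" "A \<in> MR_F" "k \<in> A"
  using assms by (auto simp: adj_def MR_edges_def)

lemma adj_MR_in_verts: "(v, w) \<in> adj MR_edges \<Longrightarrow> v \<in> MR_verts \<and> w \<in> MR_verts"
  by (erule adj_MR_cases) (auto simp: doubleton_eq_iff MR_verts_simps)

lemma adj_MR_intros:
  "1 \<le> k \<Longrightarrow> (Origin, Point k) \<in> adj MR_edges"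
  "1 \<le> k \<Longrightarrow> A \<in> MR_F \<Longrightarrow> k \<in> A \<Longrightarrow> (Point k, Segment A) \<in> adj MR_edges"
  by (auto simp: adj_def MR_edges_def)

lemma pos_if_in_MR_F: "A \<in> MR_F \<Longrightarrow> k \<in> A \<Longrightarrow> 1 \<le> k"
  by (auto simp: MR_F_def)

lemma MR_connected:
  assumes "v \<in> MR_verts" "w \<in> MR_verts"
  shows "(v, w) \<in> (adj MR_edges)\<^sup>*"
proof -
  have sym: "sym ((adj MR_edges)\<^sup>*)"
    by (intro sym_rtrancl symI) (simp add: adj_def insert_commute)
  have "(Origin, v) \<in> (adj MR_edges)\<^sup>*" if "v \<in> MR_verts" for v
    using that
  proof (cases rule: MR_verts_cases)
    case (initial j)
    then show ?thesis
      using adj_MR_intros(1)[of 1] adj_MR_intros(2)[of 1 "{1..j}"] MR_F_intros(1)[of j]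
      by (auto intro: rtrancl_into_rtrancl)
  next
    case (final j)
    then show ?thesis
      using adj_MR_intros(1)[of j] adj_MR_intros(2)[of j "{j..}"] MR_F_intros(2)[of j]
      by (auto intro: rtrancl_into_rtrancl)
  next
    case (point k)
    then show ?thesis using adj_MR_intros(1) by blast
  qed simp
  then show ?thesis using assms sym by (meson rtrancl_trans symD)
qed

text \<open>The path metric is the largest pseudometric in which adjacent vertices are at distance at most 1.\<close>

lemma le_MR_dist:
  assumes vw: "v \<in> MR_verts" "w \<in> MR_verts"
    and refl: "\<And>v. \<rho> v v = 0" and tri: "\<And>u v w. \<rho> u w \<le> \<rho> u v + \<rho> v w"
    and edge: "\<And>v w. (v, w) \<in> adj MR_edges \<Longrightarrow> \<rho> v w \<le> (1 :: real)"
  shows "\<rho> v w \<le> MR_dist v w"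
proof -
  have path: "\<rho> v w \<le> real n" if "(v, w) \<in> adj MR_edges ^^ n" for n w
    using that
  proof (induction n arbitrary: w)
    case (Suc n)
    then obtain u where "(v, u) \<in> adj MR_edges ^^ n" "(u, w) \<in> adj MR_edges" by auto
    then show ?case using Suc.IH[of u] edge[of u w] tri[of v w u] by simp
  qed (simp add: refl)
  obtain n where "(v, w) \<in> adj MR_edges ^^ n"
    using MR_connected[OF vw] by (metis rtrancl_imp_relpow)
  then have "(v, w) \<in> adj MR_edges ^^ (LEAST n. (v, w) \<in> adj MR_edges ^^ n)"
    by (rule LeastI)
  then show ?thesis using path by (simp add: MR_dist_def path_dist_def)
qed

lemma cut_adj:
  assumes "(v, w) \<in> adj MR_edges"
  shows "\<bar>cut n v - cut n w\<bar> \<le> 1"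
  using assms
proof (cases rule: adj_MR_cases)
  case (segment k A)
  from segment(3) have "\<bar>cut n (Point k) - cut n (Segment A)\<bar> \<le> 1"
  proof (cases rule: MR_F_cases)
    case (initial j)
    then show ?thesis using segment(2,4) by (auto simp: cut_initial simp del: cut.simps(3) One_nat_def)
  next
    case (final j)
    then show ?thesis using segment(2,4) by (auto simp: cut_final simp del: cut.simps(3) One_nat_def)
  qed
  then show ?thesis using segment(1) by (auto simp: doubleton_eq_iff abs_minus_commute simp del: cut.simps(3))
qed (auto simp: doubleton_eq_iff)

lemma cut_le_MR_dist:
  assumes "v \<in> MR_verts" "w \<in> MR_verts"
  shows "\<bar>cut n v - cut n w\<bar> \<le> MR_dist v w"
  using assms by (rule le_MR_dist[where \<rho> = "\<lambda>v w. \<bar>cut n v - cut n w\<bar>"]) (auto intro: cut_adj)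

interpretation MR: Metric_space MR_verts MR_dist
  by (rule Metric_space_MR)

lemma MR_dist_adj: "(v, w) \<in> adj MR_edges \<Longrightarrow> MR_dist v w \<le> 1"
  using Least_le[of "\<lambda>n. (v, w) \<in> adj MR_edges ^^ n" 1] by (simp add: MR_dist_def path_dist_def)

lemma MR_dist_Origin_Point: "1 \<le> k \<Longrightarrow> MR_dist Origin (Point k) \<le> 1"
  by (intro MR_dist_adj adj_MR_intros)

lemma MR_dist_Point_Segment: "A \<in> MR_F \<Longrightarrow> k \<in> A \<Longrightarrow> MR_dist (Point k) (Segment A) \<le> 1"
  using pos_if_in_MR_F by (intro MR_dist_adj adj_MR_intros)

lemma MR_dist_Segments:
  assumes "A \<in> MR_F" "B \<in> MR_F" "k \<in> A" "k \<in> B"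
  shows "MR_dist (Segment A) (Segment B) \<le> 2"
  using MR.triangle[of "Segment A" "Point k" "Segment B"] assms
    MR_dist_Point_Segment[of A k] MR_dist_Point_Segment[of B k] pos_if_in_MR_F[of A k]
  by (simp add: MR_verts_simps MR.commute)

lemma MR_dist_Origin_Segment:
  assumes "A \<in> MR_F"
  shows "MR_dist Origin (Segment A) \<le> 2"
proof -
  obtain k where k: "k \<in> A"
    using assms by (cases rule: MR_F_cases) (use that in force)+
  then show ?thesis
    using MR.triangle[of Origin "Point k" "Segment A"] assms MR_dist_Origin_Point[of k]
      MR_dist_Point_Segment[of A k] pos_if_in_MR_F[of A k]
    by (simp add: MR_verts_simps)
qed

lemma MR_dist_through_Origin:
  assumes "v \<in> MR_verts" "w \<in> MR_verts" "MR_dist Origin v \<le> r" "MR_dist Origin w \<le> s"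
  shows "MR_dist v w \<le> r + s"
  using MR.triangle[of v Origin w] assms by (simp add: MR_verts_simps MR.commute)

text \<open>Each pair is matched with a cut that realises an upper bound for its distance, obtained from a path
  through the origin or through a common point. A suitable \<open>n\<close> is
  \<open>k\<close> for the origin and the point \<open>k\<close>, and \<open>0\<close> for the origin and a final segment;
  the smaller of two points; the right end of an initial segment paired with anything else, the shorter
  one in case of two; the left end of the larger of two final segments; and \<open>j - 1\<close> for a point and the
  final segment from \<open>j\<close>.\<close>

lemma MR_dist_attained_by_cut:
  assumes v: "v \<in> MR_verts" and w: "w \<in> MR_verts"
  shows "\<exists>n. MR_dist v w = \<bar>cut n v - cut n w\<bar>"
proof -
  define P where "P v w \<longleftrightarrow> (\<exists>n. MR_dist v w \<le> \<bar>cut n v - cut n w\<bar>)" for v w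
  have P_sym: "P v w \<Longrightarrow> P w v" for v w
    unfolding P_def by (simp add: MR.commute abs_minus_commute)
  have P_refl: "P v v" if "v \<in> MR_verts" for v using that by (simp add: P_def)
  note [simp] = MR_verts_simps MR_F_intros
  note [simp del] = cut.simps(3) One_nat_def
  note Origin_bounds = MR_dist_Origin_Point MR_dist_Origin_Segment[OF MR_F_intros(1)]
    MR_dist_Origin_Segment[OF MR_F_intros(2)]
  have Op: "P Origin (Point k)" if "1 \<le> k" for k
    unfolding P_def using MR_dist_Origin_Point[OF that] by (intro exI[of _ k]) simp
  have Oi: "P Origin (Segment {1..j})" if "1 \<le> j" for j
    unfolding P_def using Origin_bounds(2)[OF that] that by (intro exI[of _ j]) (simp add: cut_initial)
  have Of: "P Origin (Segment {j..})" if "1 \<le> j" for j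
    unfolding P_def using Origin_bounds(3)[OF that] that by (intro exI[of _ 0]) (simp add: cut_final)
  have pp: "P (Point j) (Point k)" if "1 \<le> j" "j < k" for j k
    unfolding P_def using MR_dist_through_Origin[OF _ _ Origin_bounds(1) Origin_bounds(1), of j k] that
    by (intro exI[of _ j]) simp
  have pi: "P (Point k) (Segment {1..j})" if kj: "1 \<le> k" "1 \<le> j" for j k
  proof (cases "k \<le> j")
    case True
    then show ?thesis
      unfolding P_def using MR_dist_Point_Segment[of "{1..j}" k] kj
      by (intro exI[of _ j]) (simp add: cut_initial)
  next
    case False
    then show ?thesis
      unfolding P_def
      using MR_dist_through_Origin[OF _ _ Origin_bounds(1) Origin_bounds(2), of k j] kj
      by (intro exI[of _ j]) (simp add: cut_initial)
  qed
  have pf: "P (Point k) (Segment {j..})" if kj: "1 \<le> k" "1 \<le> j" for j k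
  proof (cases "j \<le> k")
    case True
    then have "j - 1 < k" "j - 1 < j" using kj by auto
    then show ?thesis
      unfolding P_def using MR_dist_Point_Segment[of "{j..}" k] kj True
      by (intro exI[of _ "j - 1"]) (simp add: cut_final)
  next
    case False
    then have "k \<le> j - 1" "j - 1 < j" using kj by auto
    then show ?thesis
      unfolding P_def
      using MR_dist_through_Origin[OF _ _ Origin_bounds(1) Origin_bounds(3), of k j] kj
      by (intro exI[of _ "j - 1"]) (simp add: cut_final)
  qed
  have ii: "P (Segment {1..i}) (Segment {1..j})" if "1 \<le> i" "i < j" for i j
    unfolding P_def using MR_dist_Segments[of "{1..i}" "{1..j}" 1] that
    by (intro exI[of _ i]) (simp add: cut_initial)
  have ff: "P (Segment {i..}) (Segment {j..})" if "1 \<le> i" "i < j" for i j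
    unfolding P_def using MR_dist_Segments[of "{i..}" "{j..}" j] that
    by (intro exI[of _ i]) (simp add: cut_final)
  have if': "P (Segment {1..i}) (Segment {j..})" if ij: "1 \<le> i" "1 \<le> j" for i j
  proof (cases "j \<le> i")
    case True
    then show ?thesis
      unfolding P_def using MR_dist_Segments[of "{1..i}" "{j..}" j] ij
      by (intro exI[of _ i]) (simp add: cut_initial cut_final)
  next
    case False
    then show ?thesis
      unfolding P_def
      using MR_dist_through_Origin[OF _ _ Origin_bounds(2) Origin_bounds(3), of i j] ij
      by (intro exI[of _ i]) (simp add: cut_initial cut_final)
  qed
  have pp': "P (Point j) (Point k)" if "1 \<le> j" "1 \<le> k" for j k
    using that pp P_refl P_sym by (cases j k rule: linorder_cases) auto
  have ii': "P (Segment {1..i}) (Segment {1..j})" if "1 \<le> i" "1 \<le> j" for i j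
    using that ii P_refl P_sym by (cases i j rule: linorder_cases) auto
  have ff': "P (Segment {i..}) (Segment {j..})" if "1 \<le> i" "1 \<le> j" for i j
    using that ff P_refl P_sym by (cases i j rule: linorder_cases) auto
  note * = Op Oi Of pp' pi pf ii' ff' if'
  from v have "P v w"
    by (cases rule: MR_verts_cases; use w in \<open>cases rule: MR_verts_cases\<close>)
      (auto intro: * *[THEN P_sym] P_refl)
  then obtain n where "MR_dist v w \<le> \<bar>cut n v - cut n w\<bar>" by (auto simp: P_def)
  then show ?thesis using cut_le_MR_dist[OF v w, of n] by (intro exI[of _ n]) simp
qed

section \<open>Reflexive spaces\<close>

text \<open>The conclusion says \<open>g z \<le> limsup g (x\<^sub>k)\<close> for every functional \<open>g\<close>. On the dual space this limit
  superior is a sublinear functional of \<open>g\<close>; a linear functional below it is a bounded element of the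
  bidual, and reflexivity turns it into a point.\<close>

lemma reflexive_weak_cluster_point:
  fixes x :: "nat \<Rightarrow> 'a::real_normed_vector"
  assumes refl: "reflexive_space TYPE('a)" and bdd: "bounded (range x)"
  shows "\<exists>z. \<forall>(g :: 'a \<Rightarrow>\<^sub>L real) r.
    (\<forall>\<^sub>F k in sequentially. blinfun_apply g (x k) \<le> r) \<longrightarrow> blinfun_apply g z \<le> r"
proof -
  obtain K where K: "0 < K" "\<And>k. norm (x k) \<le> K"
    using bdd unfolding bounded_pos by blast
  \<comment> \<open>the infimum of all \<open>r\<close> with \<open>R g r\<close> is the limit superior of \<open>g (x\<^sub>k)\<close>\<close>
  define R where "R g r \<longleftrightarrow> (\<forall>\<^sub>F k in sequentially. blinfun_apply g (x k) \<le> r)"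
    for g :: "'a \<Rightarrow>\<^sub>L real" and r
  have add: "R (g + h) (r + s)" if "R g r" "R h s" for g h r s
    using that unfolding R_def by eventually_elim (simp add: blinfun.add_left)
  have scale: "R (t *\<^sub>R g) (t * r)" if "0 < t" "R g r" for t g r
    using that(2) unfolding R_def by eventually_elim (use that(1) in \<open>simp add: blinfun.scaleR_left\<close>)
  have R0: "R 0 0" by (simp add: R_def)
  have pos: "0 \<le> r" if "R 0 r" for r
    using that by (simp add: R_def)
  have RK: "R g (K * norm g)" for g
  proof -
    have "g (x k) \<le> K * norm g" for k
      using norm_blinfun[of g "x k"] mult_left_mono[OF K(2)[of k], of "norm g"]
      by (simp add: mult.commute)
    then show ?thesis by (simp add: R_def)
  qed
  then have ex: "\<exists>r. R g r" for g by blast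
  have p: "sublinear (\<lambda>g. Inf {r. R g r})"
    using add scale R0 pos ex by (rule sublinear_Inf)
  have p_le: "Inf {r. R g r} \<le> r" if "R g r" for g r
    using add scale R0 pos ex that by (rule sublinear_Inf)
  obtain \<phi> where \<phi>: "linear \<phi>" "\<phi> \<le> (\<lambda>g. Inf {r. R g r})"
    using mazur_orlicz[OF p, of "{0}" "Inf {r. R 0 r}"] by auto
  have \<phi>_le: "\<phi> g \<le> r" if "R g r" for g r
    using \<phi>(2) p_le[OF that] unfolding le_fun_def by (meson order_trans)
  have "bounded_linear \<phi>" by (rule bounded_linear_functionalI[OF \<phi>(1) \<phi>_le[OF RK]])
  moreover obtain z where "canonical_embedding z = Blinfun \<phi>"
    using refl unfolding reflexive_space_def by (metis surjD)
  ultimately have "blinfun_apply g z = \<phi> g" for g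
    by (metis bounded_linear_Blinfun_apply canonical_embedding_apply)
  then show ?thesis using \<phi>_le unfolding R_def by (intro exI[of _ z]) simp
qed

text \<open>Closed balls are weakly closed.\<close>

lemma dist_weak_cluster_point_le:
  fixes z :: "'a::real_normed_vector"
  assumes z: "\<And>(g :: 'a \<Rightarrow>\<^sub>L real) r.
      (\<forall>\<^sub>F k in sequentially. blinfun_apply g (x k) \<le> r) \<Longrightarrow> blinfun_apply g z \<le> r"
    and near: "\<forall>\<^sub>F k in sequentially. dist y (x k) \<le> r"
  shows "dist y z \<le> r"
proof -
  obtain g :: "'a \<Rightarrow>\<^sub>L real" where g: "norm g \<le> 1" "norm (z - y) \<le> blinfun_apply g (z - y)"
    using norming_functional by blast
  have "\<forall>\<^sub>F k in sequentially. g (x k) \<le> r + g y"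
    using near
  proof eventually_elim
    case (elim k)
    then show ?case
      using functional_le_norm[OF g(1), of "x k - y"]
      by (simp add: blinfun.diff_right dist_norm norm_minus_commute)
  qed
  from z[OF this] show ?thesis
    using g(2) by (simp add: blinfun.diff_right dist_norm norm_minus_commute)
qed

text \<open>Mazur's lemma. The increasing union of the convex hulls of initial pieces of the sequence is convex. If
  its distance from \<open>z\<close> were at least \<open>e\<close>, a functional \<open>g\<close> would satisfy \<open>g (x\<^sub>k) \<ge> g z + e\<close> for all
  \<open>k\<close>, contradicting the choice of \<open>z\<close>.\<close>

lemma weak_cluster_point_convex_approx:
  fixes z :: "'a::real_normed_vector"
  assumes z: "\<And>(g :: 'a \<Rightarrow>\<^sub>L real) r.
      (\<forall>\<^sub>F k in sequentially. blinfun_apply g (x k) \<le> r) \<Longrightarrow> blinfun_apply g z \<le> r"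
    and e: "0 < e"
  shows "\<exists>n. \<exists>c \<in> convex hull (x ` {..n}). dist c z < e"
proof (rule ccontr)
  assume neg: "\<not> ?thesis"
  define H where "H = (\<Union>n. convex hull (x ` {..n}))"
  have "convex H"
  proof (rule convexI)
    fix a b u v assume ab: "a \<in> H" "b \<in> H" and uv: "0 \<le> u" "0 \<le> v" "u + v = (1::real)"
    then obtain n m where "a \<in> convex hull (x ` {..n})" "b \<in> convex hull (x ` {..m})"
      by (auto simp: H_def)
    moreover have "convex hull (x ` {..n}) \<subseteq> convex hull (x ` {..max n m})"
      "convex hull (x ` {..m}) \<subseteq> convex hull (x ` {..max n m})"
      by (intro hull_mono image_mono; auto)+
    ultimately have "u *\<^sub>R a + v *\<^sub>R b \<in> convex hull (x ` {..max n m})"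
      using uv by (intro convexD[OF convex_convex_hull]) auto
    then show "u *\<^sub>R a + v *\<^sub>R b \<in> H" by (auto simp: H_def)
  qed
  then have "convex ((\<lambda>c. c - z) ` H)" by (simp add: convex_translation_subtract)
  moreover have xH: "x k \<in> H" for k
    unfolding H_def by (auto intro!: exI[of _ k] hull_inc)
  moreover have "e \<le> norm d" if "d \<in> (\<lambda>c. c - z) ` H" for d
    using that neg by (auto simp: H_def dist_norm not_less)
  ultimately obtain g :: "'a \<Rightarrow>\<^sub>L real" where g: "\<forall>d \<in> (\<lambda>c. c - z) ` H. e \<le> blinfun_apply g d"
    using separate_convex_from_ball[of "(\<lambda>c. c - z) ` H" e] by blast
  have "e \<le> g (x k) - g z" for k
    using g xH[of k] by (auto simp: blinfun.diff_right)
  then have "blinfun_apply (- g) (x k) \<le> - g z - e" for k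
    by (simp add: blinfun.minus_left algebra_simps)
  then have "blinfun_apply (- g) z \<le> - g z - e" by (intro z) simp
  then show False using e by (simp add: blinfun.minus_left)
qed

text \<open>The segments \<open>A = [1, n + 1]\<close> and \<open>B = [n + 2, \<infinity>)\<close> have distance 4 in the graph, but both are mapped
  almost into the ball of radius \<open>C\<^sub>2\<close> around a weak cluster point \<open>z\<close>: \<open>B\<close> because it is adjacent to
  almost all points, \<open>A\<close> because it is adjacent to sufficiently many points to approximate \<open>z\<close> by
  their convex combinations.\<close>

theorem MR_embedding_imp_nonreflexive:
  fixes f :: "vertex \<Rightarrow> 'a::real_normed_vector"
  assumes f: "lipschitz_bounds MR_verts MR_dist dist f C1 C2" and C: "C2 < 2 * C1"
  shows "\<not> reflexive_space TYPE('a)"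
proof
  assume refl: "reflexive_space TYPE('a)"
  have C2: "0 < C2" and
    lower: "\<And>v w. v \<in> MR_verts \<Longrightarrow> w \<in> MR_verts \<Longrightarrow> C1 * MR_dist v w \<le> dist (f v) (f w)" and
    upper: "\<And>v w. v \<in> MR_verts \<Longrightarrow> w \<in> MR_verts \<Longrightarrow> dist (f v) (f w) \<le> C2 * MR_dist v w"
    using f by (auto simp: lipschitz_bounds_def)
  have edge: "dist (f v) (f w) \<le> C2" if "(v, w) \<in> adj MR_edges" for v w
    using upper[of v w] MR_dist_adj[OF that] adj_MR_in_verts[OF that] C2
      mult_left_mono[of "MR_dist v w" 1 C2] by linarith
  \<comment> \<open>the points of the graph are numbered from 1\<close>
  define x where "x k = f (Point (Suc k))" for k
  have "dist (f Origin) (x k) \<le> C2" for k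
    unfolding x_def by (intro edge adj_MR_intros) simp
  then have "bounded (range x)" unfolding bounded_def by blast
  then obtain z where z: "\<And>(g :: 'a \<Rightarrow>\<^sub>L real) r.
      (\<forall>\<^sub>F k in sequentially. blinfun_apply g (x k) \<le> r) \<Longrightarrow> blinfun_apply g z \<le> r"
    using reflexive_weak_cluster_point[OF refl] by blast
  define e where "e = 4 * C1 - 2 * C2"
  have "0 < e" using C by (simp add: e_def)
  then obtain n c where c: "c \<in> convex hull (x ` {..n})" "dist c z < e"
    using weak_cluster_point_convex_approx[OF z] by blast
  define A where "A = {1..Suc n}"
  define B where "B = {Suc (Suc n)..}"
  have AB: "A \<in> MR_F" "B \<in> MR_F" by (auto simp: A_def B_def MR_F_def)
  have "dist (f (Segment A)) (x k) \<le> C2" if "k \<le> n" for k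
    unfolding x_def dist_commute[of "f (Segment A)"]
    using that AB by (intro edge adj_MR_intros) (auto simp: A_def)
  then have "x ` {..n} \<subseteq> cball (f (Segment A)) C2" by auto
  then have "convex hull (x ` {..n}) \<subseteq> cball (f (Segment A)) C2"
    by (rule hull_minimal) (rule convex_cball)
  then have cA: "dist (f (Segment A)) c \<le> C2" using c(1) by auto
  have "dist (f (Segment B)) (x k) \<le> C2" if "Suc n \<le> k" for k
    unfolding x_def dist_commute[of "f (Segment B)"]
    using that AB by (intro edge adj_MR_intros) (auto simp: B_def)
  then have "\<forall>\<^sub>F k in sequentially. dist (f (Segment B)) (x k) \<le> C2"
    unfolding eventually_sequentially by blast
  with z have zB: "dist (f (Segment B)) z \<le> C2" by (rule dist_weak_cluster_point_le)
  have "cut (Suc n) (Segment A) - cut (Suc n) (Segment B) = 4"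
    unfolding A_def B_def by (subst cut_initial cut_final; simp)+
  then have "4 \<le> MR_dist (Segment A) (Segment B)"
    using cut_le_MR_dist[of "Segment A" "Segment B" "Suc n"] AB by (simp add: MR_verts_simps)
  moreover have "0 < C1" using C C2 by simp
  ultimately have "4 * C1 \<le> C1 * MR_dist (Segment A) (Segment B)" by simp
  also have "\<dots> \<le> dist (f (Segment A)) (f (Segment B))"
    using lower AB by (simp add: MR_verts_simps)
  also have "\<dots> \<le> dist (f (Segment A)) c + dist c z + dist (f (Segment B)) z"
    using dist_triangle[of "f (Segment A)" "f (Segment B)" c] dist_triangle[of c "f (Segment B)" z]
    by (simp add: dist_commute)
  also have "\<dots> < 4 * C1" using cA c(2) zB by (simp add: e_def)
  finally show False by simp
qed

section \<open>Renorming non-reflexive spaces\<close>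

text \<open>The supremum alone is only a seminorm; the multiple of the original norm makes it definite and
  equivalent.\<close>

lemma equivalent_norm_max_SUP:
  fixes g :: "nat \<Rightarrow> 'a::real_normed_vector \<Rightarrow>\<^sub>L real"
  assumes g: "\<And>n. norm (g n) \<le> M" and e: "0 < e"
  defines "N \<equiv> \<lambda>x. max (e * norm x) (SUP n. \<bar>g n x\<bar>)"
  shows "equivalent_norm N" and "\<bar>g n x\<bar> \<le> N x"
proof -
  have gM: "\<bar>g n x\<bar> \<le> M * norm x" for n x
    using norm_blinfun[of "g n" x] mult_right_mono[OF g[of n], of "norm x"] by simp
  then have bdd: "bdd_above (range (\<lambda>n. \<bar>g n x\<bar>))" for x
    by (auto simp: bdd_above_def)
  have M: "0 \<le> M" using g[of 0] norm_ge_zero[of "g 0"] by linarith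
  have gN: "\<bar>g n x\<bar> \<le> N x" for n x
    unfolding N_def by (intro max.coboundedI2 cSUP_upper bdd) simp
  then show "\<bar>g n x\<bar> \<le> N x" .
  have eN: "e * norm x \<le> N x" for x by (simp add: N_def)
  have N_le: "N x \<le> r" if "e * norm x \<le> r" "\<And>n. \<bar>g n x\<bar> \<le> r" for x r
    unfolding N_def using that by (intro max.boundedI cSUP_least) auto
  have nonneg: "0 \<le> N x" for x
    using gN[of 0 x] by linarith
  have "N (x + y) \<le> N x + N y" for x y
  proof (rule N_le)
    show "e * norm (x + y) \<le> N x + N y"
      using eN[of x] eN[of y] mult_left_mono[OF norm_triangle_ineq[of x y], of e] e
      by (simp add: distrib_left)
    show "\<bar>g n (x + y)\<bar> \<le> N x + N y" for n
      using gN[of n x] gN[of n y] by (simp add: blinfun.add_right)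
  qed
  moreover have scale_le: "N (c *\<^sub>R x) \<le> \<bar>c\<bar> * N x" for c x
    using mult_left_mono[OF eN[of x], of "\<bar>c\<bar>"] mult_left_mono[OF gN[of _ x], of "\<bar>c\<bar>"]
    by (intro N_le) (auto simp: blinfun.scaleR_right abs_mult mult.left_commute)
  have "N (c *\<^sub>R x) = \<bar>c\<bar> * N x" for c x
  proof (cases "c = 0")
    case True
    then show ?thesis using scale_le[of 0 x] nonneg[of 0] by simp
  next
    case False
    then have "\<bar>c\<bar> * N x \<le> \<bar>c\<bar> * (\<bar>1 / c\<bar> * N (c *\<^sub>R x))"
      using scale_le[of "1 / c" "c *\<^sub>R x"] by (intro mult_left_mono) auto
    then show ?thesis using scale_le[of c x] False by (simp add: abs_mult[symmetric])
  qed
  moreover have "N x = 0 \<longleftrightarrow> x = 0" for x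
  proof
    assume "N x = 0"
    then show "x = 0" using eN[of x] e by (simp add: mult_le_0_iff)
  next
    assume "x = 0"
    then show "N x = 0" using N_le[of 0 0] nonneg[of 0] by simp
  qed
  ultimately have "is_norm N" using nonneg by (simp add: is_norm_def)
  moreover have "N x \<le> (e + M) * norm x" for x
    using gM[of _ x] M e by (intro N_le) (auto simp: distrib_right intro: add_increasing add_increasing2)
  ultimately show "equivalent_norm N"
    using eN e M unfolding equivalent_norm_def by (meson add_pos_nonneg)
qed

text \<open>The spare vector \<open>x 0\<close> (there is no point 0 in the graph) has the value 1 under all functionals
  \<open>g\<close> that take the value 1 at \<open>x 0, \<dots>, x n\<close> and \<open>-1\<close> afterwards, so adding and subtracting it
  shifts the values \<open>\<plusminus> 1\<close> of \<open>g\<close> at \<open>x j\<close> to those of \<open>cut n\<close> at the two segments with endpoint \<open>j\<close>.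
  The last element of a finite segment is its maximum, the first one of an infinite segment its infimum.\<close>

fun MR_vector :: "(nat \<Rightarrow> 'a::real_vector) \<Rightarrow> vertex \<Rightarrow> 'a" where
  "MR_vector x Origin = 0"
| "MR_vector x (Point k) = x k"
| "MR_vector x (Segment A) = (if finite A then x (Max A) + x 0 else x (Inf A) - x 0)"

lemma MR_vector_initial: "1 \<le> j \<Longrightarrow> MR_vector x (Segment {1..j}) = x j + x 0"
  using Max_eqI[of "{1..j}" j] by simp

lemma MR_vector_final: "MR_vector x (Segment {j..}) = x j - x 0"
  by (simp add: infinite_Ici)

lemma linear_MR_vector_eq_cut:
  fixes g :: "'a::real_vector \<Rightarrow> real"
  assumes g: "linear g" and gx: "\<And>k. g (x k) = (if k \<le> n then 1 else - 1)"
    and v: "v \<in> MR_verts"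
  shows "g (MR_vector x v) = cut n v"
  using v
proof (cases rule: MR_verts_cases)
  case origin
  then show ?thesis by (simp add: linear_0[OF g])
next
  case (point k)
  then show ?thesis by (simp add: gx)
next
  case (initial j)
  then show ?thesis by (simp only: MR_vector_initial cut_initial linear_add[OF g] gx) simp
next
  case (final j)
  then show ?thesis by (simp only: MR_vector_final cut_final linear_diff[OF g] gx) simp
qed

lemma norm_MR_vector_le:
  fixes x :: "nat \<Rightarrow> 'a::real_normed_vector"
  assumes x: "\<And>k. norm (x k) \<le> M"
  shows "norm (MR_vector x v) \<le> 2 * M"
proof -
  have "0 \<le> M" using x[of 0] norm_ge_zero[of "x 0"] by linarith
  then have "norm (x j) \<le> 2 * M" for j using x[of j] by linarith
  moreover have "norm (x j + x 0) \<le> 2 * M" "norm (x j - x 0) \<le> 2 * M" for j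
    using norm_triangle_ineq[of "x j" "x 0"] norm_triangle_ineq4[of "x j" "x 0"] x[of j] x[of 0]
    by linarith+
  ultimately show ?thesis using \<open>0 \<le> M\<close> by (cases v) auto
qed

text \<open>The new norm measures edges by at most 1, so it is at most the graph distance on all pairs. It is at
  least the graph distance because it dominates every cut.\<close>

theorem nonreflexive_renorming:
  fixes X :: "'a::banach itself"
  assumes "\<not> reflexive_space X"
  shows "\<exists>N :: 'a \<Rightarrow> real. equivalent_norm N \<and>
    isometrically_embeds MR_verts MR_dist UNIV (\<lambda>x y. N (x - y))"
proof -
  obtain f :: "nat \<Rightarrow> 'a \<Rightarrow>\<^sub>L real" and x :: "nat \<Rightarrow> 'a" and M :: real
    where M: "0 < M" and f: "\<And>n. norm (f n) \<le> M" and x: "\<And>k. norm (x k) \<le> M"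
      and fx: "\<And>n k. blinfun_apply (f n) (x k) = (if n \<le> k then 1 else 0)"
    by (rule james_sequences[OF assms]) (rule that)
  define g where "g n = f 0 - 2 *\<^sub>R f (Suc n)" for n
  \<comment> \<open>the images of the vertices have norm at most \<open>2 * M\<close>, so this multiple of the norm is at most 1 on edges\<close>
  define N where "N = (\<lambda>y. max (1 / (4 * M) * norm y) (SUP n. \<bar>g n y\<bar>))"
  have gM: "norm (g n) \<le> 3 * M" for n
    using norm_triangle_ineq4[of "f 0" "2 *\<^sub>R f (Suc n)"] f[of 0] f[of "Suc n"] by (simp add: g_def)
  have eqv: "equivalent_norm N" and gN: "\<And>n y. \<bar>g n y\<bar> \<le> N y"
    unfolding N_def using M by (intro equivalent_norm_max_SUP[OF gM]; simp)+
  have g_cut: "g n (MR_vector x v) = cut n v" if "v \<in> MR_verts" for n v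
  proof (rule linear_MR_vector_eq_cut[OF _ _ that])
    show "linear (g n)" by (simp add: blinfun.bounded_linear_right bounded_linear.linear)
    show "g n (x k) = (if k \<le> n then 1 else - 1)" for k
      by (simp add: g_def blinfun.diff_left blinfun.scaleR_left fx)
  qed
  have "N (MR_vector x v - MR_vector x w) = MR_dist v w"
    if v: "v \<in> MR_verts" and w: "w \<in> MR_verts" for v w
  proof (rule antisym)
    have norm: "is_norm N" using eqv by (simp add: equivalent_norm_def)
    show "N (MR_vector x v - MR_vector x w) \<le> MR_dist v w"
    proof (rule le_MR_dist[OF v w])
      show "N (MR_vector x v - MR_vector x v) = 0" for v
        using norm by (simp add: is_norm_def)
      show "N (MR_vector x u - MR_vector x w)
          \<le> N (MR_vector x u - MR_vector x v) + N (MR_vector x v - MR_vector x w)" for u v w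
        using norm unfolding is_norm_def by (metis diff_add_cancel add_diff_eq)
      fix v w assume vw: "(v, w) \<in> adj MR_edges"
      have "norm (MR_vector x v - MR_vector x w) \<le> 4 * M"
        using norm_triangle_ineq4[of "MR_vector x v" "MR_vector x w"] norm_MR_vector_le[of x M, OF x, of v]
          norm_MR_vector_le[of x M, OF x, of w] by linarith
      then have "1 / (4 * M) * norm (MR_vector x v - MR_vector x w) \<le> 1"
        using M by simp
      moreover have "\<bar>g n (MR_vector x v - MR_vector x w)\<bar> \<le> 1" for n
        using cut_adj[OF vw] adj_MR_in_verts[OF vw] by (simp add: blinfun.diff_right g_cut)
      ultimately show "N (MR_vector x v - MR_vector x w) \<le> 1"
        unfolding N_def by (intro max.boundedI cSUP_least) auto
    qed
    obtain n where "MR_dist v w = \<bar>cut n v - cut n w\<bar>"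
      using MR_dist_attained_by_cut[OF v w] by blast
    also have "\<dots> = \<bar>g n (MR_vector x v - MR_vector x w)\<bar>"
      using v w by (simp add: blinfun.diff_right g_cut)
    finally show "MR_dist v w \<le> N (MR_vector x v - MR_vector x w)" using gN by simp
  qed
  then show ?thesis using eqv unfolding isometrically_embeds_def by blast
qed

theorem theorem3:
  shows "(\<forall>D::real. 1 \<le> D \<and> D < 2 \<and>
             lipschitz_embeds MR_verts MR_dist (UNIV :: 'a::banach set) dist D
           \<longrightarrow> \<not> reflexive_space TYPE('a))
       \<and> (\<not> reflexive_space TYPE('a)
           \<longrightarrow> (\<exists>N :: 'a \<Rightarrow> real. equivalent_norm N \<and>
                 isometrically_embeds MR_verts MR_dist UNIV (\<lambda>x y. N (x - y))))"
proof (intro conjI allI impI)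
  fix D :: real
  assume D: "1 \<le> D \<and> D < 2 \<and>
    lipschitz_embeds MR_verts MR_dist (UNIV :: 'a::banach set) dist D"
  then obtain f :: "vertex \<Rightarrow> 'a" where
    f: "\<exists>C1 C2. lipschitz_bounds MR_verts MR_dist dist f C1 C2"
      "distortion MR_verts MR_dist dist f \<le> D"
    by (auto simp: lipschitz_embeds_def lipschitz_embedding_def)
  \<comment> \<open>an infimum below 2 leaves room for constants whose ratio is below 2\<close>
  have "\<exists>q \<in> {C2 / C1 |C1 C2. lipschitz_bounds MR_verts MR_dist dist f C1 C2}. q < 2"
    using f D by (intro cInf_lessD) (auto simp: distortion_def)
  then obtain C1 C2 where C: "lipschitz_bounds MR_verts MR_dist dist f C1 C2" "C2 / C1 < 2" by blast
  moreover have "0 < C1" using C(1) by (simp add: lipschitz_bounds_def)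
  ultimately show "\<not> reflexive_space TYPE('a)"
    by (intro MR_embedding_imp_nonreflexive[of f C1 C2]) (auto simp: field_simps)
qed (rule nonreflexive_renorming)

end
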